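(* Let $\mathcal L$ be an MV-algebra and let $P$ be a prime implication filter of $\mathcal L$. Then $\mathrm{PSpec}(P)$ is order-isomorphic to $\mathrm{PSpec}(\mathcal L/\ell(P))$, both sets being ordered by inclusion.
   Context: In an MV-algebra $(\mathcal L,\oplus,\lnot,0)$: $1=\lnot 0$, $x\otimes y=\lnot(\lnot x\oplus\lnot y)$, $x\to y=\lnot x\oplus y$, $x\le y$ iff $x\to y=1$, and $\vee,\wedge$ are the lattice operations for $\le$. An implication filter is a lattice filter (nonempty, upward closed, closed under $\wedge$; possibly all of $\mathcal L$) which is closed under powers $x^n=x\otimes\cdots\otimes x$. A prime implication filter is a proper implication filter $F$ such that $a\vee b\in F$ implies $a\in F$ or $b\in F$. For an MV-algebra $\mathcal M$, $\mathrm{PSpec}(\mathcal M)$ is the set of all prime implication filters of $\mathcal M$. For a prime implication filter $P$ of $\mathcal L$, $\mathrm{PSpec}(P)$ is the set of prime implication filters $F$ of $\mathcal L$ that are comparable to $P$, i.e. $F\subseteq P$ or $P\subseteq F$; and $\ell(P)$ is the implication filter of $\mathcal L$ generated by $\{x\to p : p\in P,\ x\in\mathcal L\setminus P\}$. For an implication filter $G$, $\mathcal L/G$ is the quotient MV-algebra by the congruence $a\sim b$ iff $a\to b\in G$ and $b\to a\in G$; $\mathcal L/\ell(P)$ is called the localization of $\mathcal L$ at $P$. *)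

theory Defs
  imports "HOL-Algebra.Lattice" "HOL.Hull"
begin

record 'a mv_structure = "'a partial_object" +
  mv_plus :: "'a \<Rightarrow> 'a \<Rightarrow> 'a" (infixl \<open>\<oplus>\<index>\<close> 65)
  mv_neg :: "'a \<Rightarrow> 'a" (\<open>\<sim>\<index> _\<close> [81] 80)
  mv_zero :: 'a (\<open>\<zero>\<index>\<close>)

locale mv_algebra =
  fixes L :: "('a, 'm) mv_structure_scheme" (structure)
  assumes plus_closed: "\<lbrakk>x \<in> carrier L; y \<in> carrier L\<rbrakk> \<Longrightarrow> x \<oplus> y \<in> carrier L"
    and neg_closed: "x \<in> carrier L \<Longrightarrow> \<sim> x \<in> carrier L"
    and zero_closed: "\<zero> \<in> carrier L"
    and plus_assoc: "\<lbrakk>x \<in> carrier L; y \<in> carrier L; z \<in> carrier L\<rbrakk> \<Longrightarrow> (x \<oplus> y) \<oplus> z = x \<oplus> (y \<oplus> z)"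
    and plus_comm: "\<lbrakk>x \<in> carrier L; y \<in> carrier L\<rbrakk> \<Longrightarrow> x \<oplus> y = y \<oplus> x"
    and plus_zero: "x \<in> carrier L \<Longrightarrow> x \<oplus> \<zero> = x"
    and neg_neg: "x \<in> carrier L \<Longrightarrow> \<sim> (\<sim> x) = x"
    and plus_neg_zero: "x \<in> carrier L \<Longrightarrow> x \<oplus> \<sim> \<zero> = \<sim> \<zero>"
    and lukasiewicz: "\<lbrakk>x \<in> carrier L; y \<in> carrier L\<rbrakk> \<Longrightarrow> \<sim> (\<sim> x \<oplus> y) \<oplus> y = \<sim> (\<sim> y \<oplus> x) \<oplus> x"

definition mv_one :: "('a, 'm) mv_structure_scheme \<Rightarrow> 'a" (\<open>\<one>\<index>\<close>)
  where "\<one>\<^bsub>L\<^esub> = \<sim>\<^bsub>L\<^esub> \<zero>\<^bsub>L\<^esub>"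

definition mv_times :: "('a, 'm) mv_structure_scheme \<Rightarrow> 'a \<Rightarrow> 'a \<Rightarrow> 'a" (infixl \<open>\<otimes>\<index>\<close> 70)
  where "x \<otimes>\<^bsub>L\<^esub> y = \<sim>\<^bsub>L\<^esub> (\<sim>\<^bsub>L\<^esub> x \<oplus>\<^bsub>L\<^esub> \<sim>\<^bsub>L\<^esub> y)"

definition mv_imp :: "('a, 'm) mv_structure_scheme \<Rightarrow> 'a \<Rightarrow> 'a \<Rightarrow> 'a" (infixr \<open>\<rightarrow>\<index>\<close> 60)
  where "x \<rightarrow>\<^bsub>L\<^esub> y = \<sim>\<^bsub>L\<^esub> x \<oplus>\<^bsub>L\<^esub> y"

(* The power with exponent 0 is 1, which lies in every nonempty upward closed set, so
   closure under all powers is the same as closure under powers with positive exponent. *)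
primrec mv_power :: "('a, 'm) mv_structure_scheme \<Rightarrow> 'a \<Rightarrow> nat \<Rightarrow> 'a" where
  "mv_power L x 0 = \<one>\<^bsub>L\<^esub>"
| "mv_power L x (Suc n) = x \<otimes>\<^bsub>L\<^esub> mv_power L x n"

definition mv_order :: "('a, 'm) mv_structure_scheme \<Rightarrow> 'a gorder"
  where "mv_order L =
    \<lparr>carrier = carrier L, eq = (=), le = (\<lambda>x y. x \<rightarrow>\<^bsub>L\<^esub> y = \<one>\<^bsub>L\<^esub>)\<rparr>"

definition lattice_filter :: "('a, 'm) mv_structure_scheme \<Rightarrow> 'a set \<Rightarrow> bool"
  where "lattice_filter L F \<longleftrightarrow>
    F \<subseteq> carrier L \<and> F \<noteq> {} \<and>
    (\<forall>x\<in>F. \<forall>y\<in>carrier L. x \<sqsubseteq>\<^bsub>mv_order L\<^esub> y \<longrightarrow> y \<in> F) \<and>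
    (\<forall>x\<in>F. \<forall>y\<in>F. x \<sqinter>\<^bsub>mv_order L\<^esub> y \<in> F)"

definition implication_filter :: "('a, 'm) mv_structure_scheme \<Rightarrow> 'a set \<Rightarrow> bool"
  where "implication_filter L F \<longleftrightarrow>
    lattice_filter L F \<and> (\<forall>x\<in>F. \<forall>n. mv_power L x n \<in> F)"

definition prime_implication_filter :: "('a, 'm) mv_structure_scheme \<Rightarrow> 'a set \<Rightarrow> bool"
  where "prime_implication_filter L F \<longleftrightarrow>
    implication_filter L F \<and> F \<noteq> carrier L \<and>
    (\<forall>a\<in>carrier L. \<forall>b\<in>carrier L. a \<squnion>\<^bsub>mv_order L\<^esub> b \<in> F \<longrightarrow> a \<in> F \<or> b \<in> F)"

definition PSpec :: "('a, 'm) mv_structure_scheme \<Rightarrow> 'a set set"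
  where "PSpec L = {F. prime_implication_filter L F}"

definition PSpec_at :: "('a, 'm) mv_structure_scheme \<Rightarrow> 'a set \<Rightarrow> 'a set set"
  where "PSpec_at L P = {F \<in> PSpec L. F \<subseteq> P \<or> P \<subseteq> F}"

definition localizing_filter :: "('a, 'm) mv_structure_scheme \<Rightarrow> 'a set \<Rightarrow> 'a set"
  where "localizing_filter L P =
    implication_filter L hull {x \<rightarrow>\<^bsub>L\<^esub> p | x p. p \<in> P \<and> x \<in> carrier L - P}"

definition filter_cong :: "('a, 'm) mv_structure_scheme \<Rightarrow> 'a set \<Rightarrow> ('a \<times> 'a) set"
  where "filter_cong L G =
    {(a, b). a \<in> carrier L \<and> b \<in> carrier L \<and> a \<rightarrow>\<^bsub>L\<^esub> b \<in> G \<and> b \<rightarrow>\<^bsub>L\<^esub> a \<in> G}"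

(* The unions below range over all representatives; for an implication filter G they are
   unions of equal classes, so they give the class of the result on any representatives. *)
definition mv_quotient :: "('a, 'm) mv_structure_scheme \<Rightarrow> 'a set \<Rightarrow> 'a set mv_structure"
  where "mv_quotient L G =
    \<lparr>carrier = carrier L // filter_cong L G,
     mv_plus = (\<lambda>A B. \<Union>a\<in>A. \<Union>b\<in>B. filter_cong L G `` {a \<oplus>\<^bsub>L\<^esub> b}),
     mv_neg = (\<lambda>A. \<Union>a\<in>A. filter_cong L G `` {\<sim>\<^bsub>L\<^esub> a}),
     mv_zero = filter_cong L G `` {\<zero>\<^bsub>L\<^esub>}\<rparr>"

definition localization :: "('a, 'm) mv_structure_scheme \<Rightarrow> 'a set \<Rightarrow> 'a set mv_structure"
  where "localization L P = mv_quotient L (localizing_filter L P)"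

definition inclusion_isomorphic :: "'a set set \<Rightarrow> 'b set set \<Rightarrow> bool"
  where "inclusion_isomorphic \<A> \<B> \<longleftrightarrow>
    (\<exists>f. bij_betw f \<A> \<B> \<and> (\<forall>F\<in>\<A>. \<forall>G\<in>\<A>. F \<subseteq> G \<longleftrightarrow> f F \<subseteq> f G))"

end

theory Submission
  imports Defs
begin

text \<open>
  The primes comparable to \<open>P\<close> are exactly the primes that contain \<open>\<ell>(P)\<close>
  (\<open>localizing_filter_subset_iff\<close>), and for every implication filter \<open>G\<close> the primes of the
  quotient by \<open>G\<close> are the images of the primes that contain \<open>G\<close>
  (\<open>inclusion_isomorphic_PSpec\<close>, applied to the quotient map, whose kernel is \<open>G\<close>).

  For the first part let \<open>F\<close> contain \<open>\<ell>(P)\<close>. If there were \<open>p \<in> P - F\<close> and \<open>x \<in> F - P\<close>, then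
  \<open>x \<rightarrow> p\<close> would be one of the generators of \<open>\<ell>(P)\<close>, so modus ponens in \<open>F\<close> would give \<open>p \<in> F\<close>.
  Conversely, let \<open>F\<close> be a prime comparable to \<open>P\<close> and \<open>x \<rightarrow> p\<close> a generator. If \<open>P \<subseteq> F\<close>, then
  \<open>p \<in> F\<close> and \<open>p \<le> x \<rightarrow> p\<close>. If \<open>F \<subseteq> P\<close>, prelinearity \<open>(x \<rightarrow> p) \<or> (p \<rightarrow> x) = 1\<close> puts \<open>x \<rightarrow> p\<close>
  or \<open>p \<rightarrow> x\<close> into \<open>F\<close>; the latter would lie in \<open>P\<close> and force \<open>x \<in> P\<close>.

  Both parts rest on describing an implication filter as a deductive system, a set that
  contains \<open>1\<close> and is closed under modus ponens (\<open>implication_filter_iff\<close>), and on the identity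
  \<open>x \<or> y = (x \<rightarrow> y) \<rightarrow> y\<close> (\<open>join_eq\<close>). In this form filters and primeness are expressed through
  the algebraic operations alone, so homomorphisms transport them.
\<close>

text \<open>The arrow denotes only the MV implication; function sets do not occur below.\<close>

no_notation funcset (infixr \<open>\<rightarrow>\<close> 60)

section \<open>Arithmetic of implication\<close>

context mv_algebra
begin

declare plus_closed [simp] neg_closed [simp] zero_closed [simp] neg_neg [simp] plus_zero [simp]

lemma one_closed [simp]: "\<one> \<in> carrier L"
  by (simp add: mv_one_def)

lemma imp_closed [simp]: "x \<in> carrier L \<Longrightarrow> y \<in> carrier L \<Longrightarrow> x \<rightarrow> y \<in> carrier L"
  by (simp add: mv_imp_def)

lemma times_closed [simp]: "x \<in> carrier L \<Longrightarrow> y \<in> carrier L \<Longrightarrow> x \<otimes> y \<in> carrier L"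
  by (simp add: mv_times_def)

lemma plus_left_comm:
  "x \<in> carrier L \<Longrightarrow> y \<in> carrier L \<Longrightarrow> z \<in> carrier L \<Longrightarrow> x \<oplus> (y \<oplus> z) = y \<oplus> (x \<oplus> z)"
  by (metis plus_assoc plus_comm)

lemma plus_one [simp]: "x \<in> carrier L \<Longrightarrow> x \<oplus> \<one> = \<one>" "x \<in> carrier L \<Longrightarrow> \<one> \<oplus> x = \<one>"
  by (simp_all add: mv_one_def plus_neg_zero plus_comm)

lemma zero_plus [simp]: "x \<in> carrier L \<Longrightarrow> \<zero> \<oplus> x = x"
  using plus_comm[of "\<zero>" x] by simp

lemma neg_one [simp]: "\<sim> \<one> = \<zero>" and neg_zero [simp]: "\<sim> \<zero> = \<one>"
  by (simp_all add: mv_one_def)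

lemma imp_self [simp]: "x \<in> carrier L \<Longrightarrow> x \<rightarrow> x = \<one>"
  using lukasiewicz[of x "\<one>"] by (simp add: mv_imp_def)

lemma imp_one [simp]: "x \<in> carrier L \<Longrightarrow> x \<rightarrow> \<one> = \<one>"
  and one_imp [simp]: "x \<in> carrier L \<Longrightarrow> \<one> \<rightarrow> x = x"
  by (simp_all add: mv_imp_def)

lemma imp_exchange:
  "x \<in> carrier L \<Longrightarrow> y \<in> carrier L \<Longrightarrow> z \<in> carrier L \<Longrightarrow> x \<rightarrow> y \<rightarrow> z = y \<rightarrow> x \<rightarrow> z"
  by (simp add: mv_imp_def plus_left_comm)

lemma times_imp:
  "x \<in> carrier L \<Longrightarrow> y \<in> carrier L \<Longrightarrow> z \<in> carrier L \<Longrightarrow> x \<otimes> y \<rightarrow> z = x \<rightarrow> y \<rightarrow> z"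
  by (simp add: mv_imp_def mv_times_def plus_assoc)

lemma imp_contrapos:
  "x \<in> carrier L \<Longrightarrow> y \<in> carrier L \<Longrightarrow> \<sim> x \<rightarrow> \<sim> y = y \<rightarrow> x"
  by (simp add: mv_imp_def plus_comm)

lemma imp_weaken [simp]: "x \<in> carrier L \<Longrightarrow> y \<in> carrier L \<Longrightarrow> x \<rightarrow> y \<rightarrow> x = \<one>"
  by (simp add: imp_exchange[of x y x])

lemma imp_imp_commute:
  "x \<in> carrier L \<Longrightarrow> y \<in> carrier L \<Longrightarrow> (x \<rightarrow> y) \<rightarrow> y = (y \<rightarrow> x) \<rightarrow> x"
  using lukasiewicz by (simp add: mv_imp_def)

lemma imp_antisym:
  "x \<in> carrier L \<Longrightarrow> y \<in> carrier L \<Longrightarrow> x \<rightarrow> y = \<one> \<Longrightarrow> y \<rightarrow> x = \<one> \<Longrightarrow> x = y"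
  using imp_imp_commute[of x y] by simp

text \<open>
  The MV order is the algebraic order of the monoid: if \<open>x \<rightarrow> y = 1\<close>, then
  \<open>y = (x \<rightarrow> y) \<rightarrow> y = (y \<rightarrow> x) \<rightarrow> x\<close>, which exhibits \<open>y\<close> as a sum with summand \<open>x\<close>.
  Monotonicity of the operations becomes associativity of the sum.
\<close>

lemma le_iff_plus:
  assumes "x \<in> carrier L" "y \<in> carrier L"
  shows "x \<rightarrow> y = \<one> \<longleftrightarrow> (\<exists>c\<in>carrier L. y = x \<oplus> c)"
proof
  assume "x \<rightarrow> y = \<one>"
  then have "y = x \<oplus> \<sim> (y \<rightarrow> x)"
    using imp_imp_commute[OF assms] assms
    by (simp add: mv_imp_def[of L "_ \<rightarrow> _"] plus_comm)
  then show "\<exists>c\<in>carrier L. y = x \<oplus> c"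
    using assms by (metis imp_closed neg_closed)
next
  assume "\<exists>c\<in>carrier L. y = x \<oplus> c"
  then obtain c where "c \<in> carrier L" "y = x \<oplus> c" by blast
  with assms imp_self[of x] show "x \<rightarrow> y = \<one>"
    by (simp add: mv_imp_def plus_assoc[symmetric])
qed

lemma imp_mono_right:
  assumes "w \<in> carrier L" "y \<in> carrier L" "z \<in> carrier L" "y \<rightarrow> z = \<one>"
  shows "(w \<rightarrow> y) \<rightarrow> w \<rightarrow> z = \<one>"
proof -
  obtain c where "c \<in> carrier L" "z = y \<oplus> c"
    using assms le_iff_plus by blast
  then have "w \<rightarrow> z = (w \<rightarrow> y) \<oplus> c" "c \<in> carrier L"
    using assms by (simp_all add: mv_imp_def plus_assoc)
  then show ?thesis
    using assms by (subst le_iff_plus) auto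
qed

lemma imp_syllogism:
  assumes [simp]: "x \<in> carrier L" "y \<in> carrier L" "z \<in> carrier L"
  shows "(x \<rightarrow> y) \<rightarrow> (y \<rightarrow> z) \<rightarrow> x \<rightarrow> z = \<one>"
proof -
  have "y \<rightarrow> (y \<rightarrow> z) \<rightarrow> z = \<one>"
    by (simp add: imp_exchange[of y "y \<rightarrow> z" z])
  then have "(x \<rightarrow> y) \<rightarrow> x \<rightarrow> (y \<rightarrow> z) \<rightarrow> z = \<one>"
    by (intro imp_mono_right) auto
  then show ?thesis
    by (simp add: imp_exchange[of x "y \<rightarrow> z" z])
qed

lemma imp_trans:
  assumes "x \<in> carrier L" "y \<in> carrier L" "z \<in> carrier L" "x \<rightarrow> y = \<one>" "y \<rightarrow> z = \<one>"
  shows "x \<rightarrow> z = \<one>"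
  using imp_syllogism[OF assms(1-3)] assms by simp

lemma imp_mono_left:
  assumes "x \<in> carrier L" "y \<in> carrier L" "z \<in> carrier L" "x \<rightarrow> y = \<one>"
  shows "(y \<rightarrow> z) \<rightarrow> x \<rightarrow> z = \<one>"
  using imp_syllogism[OF assms(1-3)] assms by simp

section \<open>Lattice operations and prelinearity\<close>

text \<open>
  The Lukasiewicz identity says that \<open>(x \<rightarrow> y) \<rightarrow> y\<close> is symmetric in \<open>x\<close> and \<open>y\<close>. It is
  monotone in \<open>x\<close>, so for an upper bound \<open>z\<close> it is at most
  \<open>(z \<rightarrow> y) \<rightarrow> y = (y \<rightarrow> z) \<rightarrow> z = z\<close>.
\<close>

lemma join_lub:
  assumes [simp]: "x \<in> carrier L" "y \<in> carrier L"
  shows "is_lub (mv_order L) ((x \<rightarrow> y) \<rightarrow> y) {x, y}"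
proof -
  have bound: "((x \<rightarrow> y) \<rightarrow> y) \<rightarrow> z = \<one>"
    if [simp]: "z \<in> carrier L" and le: "x \<rightarrow> z = \<one>" "y \<rightarrow> z = \<one>" for z
  proof -
    have "(z \<rightarrow> y) \<rightarrow> x \<rightarrow> y = \<one>"
      by (rule imp_mono_left) (simp_all add: le)
    then have "((x \<rightarrow> y) \<rightarrow> y) \<rightarrow> (z \<rightarrow> y) \<rightarrow> y = \<one>"
      by (simp add: imp_mono_left)
    then show ?thesis
      by (simp add: imp_imp_commute[of z y] le)
  qed
  have "x \<rightarrow> (x \<rightarrow> y) \<rightarrow> y = \<one>"
    by (simp add: imp_exchange[of x "x \<rightarrow> y" y])
  then show ?thesis
    using bound by (auto simp: least_def Upper_def mv_order_def)
qed

lemma join_eq: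
  assumes [simp]: "x \<in> carrier L" "y \<in> carrier L"
  shows "x \<squnion>\<^bsub>mv_order L\<^esub> y = (x \<rightarrow> y) \<rightarrow> y"
proof -
  note lub = join_lub[OF assms]
  have "u = (x \<rightarrow> y) \<rightarrow> y" if u: "is_lub (mv_order L) u {x, y}" for u
  proof (rule imp_antisym)
    show "u \<rightarrow> (x \<rightarrow> y) \<rightarrow> y = \<one>" "((x \<rightarrow> y) \<rightarrow> y) \<rightarrow> u = \<one>"
      using least_le[OF u least_mem[OF lub]] least_le[OF lub least_mem[OF u]]
      by (simp_all add: mv_order_def)
    show "u \<in> carrier L"
      using least_closed[OF u] by (simp add: mv_order_def)
  qed simp
  with lub show ?thesis
    unfolding join_def sup_def by (intro some_equality)
qed

text \<open>
  Negation is an order-reversing involution, so it turns the join of the negations into the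
  meet.
\<close>

lemma meet_glb:
  assumes [simp]: "x \<in> carrier L" "y \<in> carrier L"
  shows "is_glb (mv_order L) (x \<sqinter>\<^bsub>mv_order L\<^esub> y) {x, y}"
proof -
  define j where "j = (\<sim> x \<rightarrow> \<sim> y) \<rightarrow> \<sim> y"
  have "is_lub (mv_order L) j {\<sim> x, \<sim> y}"
    unfolding j_def by (rule join_lub) simp_all
  then have [simp]: "j \<in> carrier L" and above: "\<sim> x \<rightarrow> j = \<one>" "\<sim> y \<rightarrow> j = \<one>"
    and least: "\<And>z. \<lbrakk>z \<in> carrier L; \<sim> x \<rightarrow> z = \<one>; \<sim> y \<rightarrow> z = \<one>\<rbrakk> \<Longrightarrow> j \<rightarrow> z = \<one>"
    by (auto simp: least_def Upper_def mv_order_def)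
  have "\<sim> j \<rightarrow> x = \<one>" "\<sim> j \<rightarrow> y = \<one>"
    using above imp_contrapos[of x "\<sim> j"] imp_contrapos[of y "\<sim> j"] by simp_all
  moreover have "z \<rightarrow> \<sim> j = \<one>"
    if "z \<in> carrier L" "z \<rightarrow> x = \<one>" "z \<rightarrow> y = \<one>" for z
    using that least[of "\<sim> z"] imp_contrapos[of x z] imp_contrapos[of y z]
      imp_contrapos[of "\<sim> j" z] by simp
  ultimately have "is_glb (mv_order L) (\<sim> j) {x, y}"
    by (auto simp: greatest_def Lower_def mv_order_def)
  then show ?thesis
    unfolding meet_def inf_def by (rule someI)
qed

lemma meet_closed [simp]:
    "x \<in> carrier L \<Longrightarrow> y \<in> carrier L \<Longrightarrow> x \<sqinter>\<^bsub>mv_order L\<^esub> y \<in> carrier L"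
  and meet_le1: "x \<in> carrier L \<Longrightarrow> y \<in> carrier L \<Longrightarrow> (x \<sqinter>\<^bsub>mv_order L\<^esub> y) \<rightarrow> x = \<one>"
  and meet_le2: "x \<in> carrier L \<Longrightarrow> y \<in> carrier L \<Longrightarrow> (x \<sqinter>\<^bsub>mv_order L\<^esub> y) \<rightarrow> y = \<one>"
  and meet_greatest: "x \<in> carrier L \<Longrightarrow> y \<in> carrier L \<Longrightarrow> z \<in> carrier L \<Longrightarrow>
    z \<rightarrow> x = \<one> \<Longrightarrow> z \<rightarrow> y = \<one> \<Longrightarrow> z \<rightarrow> (x \<sqinter>\<^bsub>mv_order L\<^esub> y) = \<one>"
  using meet_glb[of x y] by (auto simp: greatest_def Lower_def mv_order_def)

lemma times_comm: "x \<in> carrier L \<Longrightarrow> y \<in> carrier L \<Longrightarrow> x \<otimes> y = y \<otimes> x"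
  by (simp add: mv_times_def plus_comm)

lemma times_assoc:
  "x \<in> carrier L \<Longrightarrow> y \<in> carrier L \<Longrightarrow> z \<in> carrier L \<Longrightarrow> (x \<otimes> y) \<otimes> z = x \<otimes> (y \<otimes> z)"
  by (simp add: mv_times_def plus_assoc)

lemma times_left_comm:
  "x \<in> carrier L \<Longrightarrow> y \<in> carrier L \<Longrightarrow> z \<in> carrier L \<Longrightarrow> x \<otimes> (y \<otimes> z) = y \<otimes> (x \<otimes> z)"
  by (simp add: mv_times_def plus_left_comm)

lemma times_one [simp]: "x \<in> carrier L \<Longrightarrow> x \<otimes> \<one> = x"
  and zero_times [simp]: "x \<in> carrier L \<Longrightarrow> \<zero> \<otimes> x = \<zero>"
  by (simp_all add: mv_times_def)

lemma times_neg [simp]: "x \<in> carrier L \<Longrightarrow> \<sim> x \<otimes> x = \<zero>"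
  using imp_self[of "\<sim> x"] by (simp add: mv_times_def mv_imp_def)

text \<open>
  The De Morgan dual of the symmetry of the join; both sides are the meet of \<open>x\<close> and \<open>y\<close>.
\<close>

lemma divisibility:
  assumes "x \<in> carrier L" "y \<in> carrier L"
  shows "x \<otimes> (x \<rightarrow> y) = y \<otimes> (y \<rightarrow> x)"
  using assms imp_imp_commute[of "\<sim> x" "\<sim> y"]
  by (simp add: mv_times_def mv_imp_def plus_comm)

text \<open>
  The dual statement is that the differences \<open>a = x \<otimes> \<sim> y\<close> and \<open>b = y \<otimes> \<sim> x\<close> have meet
  \<open>0\<close>. Their meet is \<open>a \<otimes> (a \<rightarrow> b)\<close>, and three exchanges by divisibility bring out
  the factor \<open>\<sim> x \<otimes> x = 0\<close>.
\<close>

lemma prelinearity: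
  assumes [simp]: "x \<in> carrier L" "y \<in> carrier L"
  shows "(x \<rightarrow> y) \<squnion>\<^bsub>mv_order L\<^esub> (y \<rightarrow> x) = \<one>"
proof -
  define a b where "a = x \<otimes> \<sim> y" and "b = y \<otimes> \<sim> x"
  have [simp]: "a \<in> carrier L" "b \<in> carrier L"
    by (simp_all add: a_def b_def)
  define w where "w = x \<rightarrow> b"
  have [simp]: "w \<in> carrier L"
    by (simp add: w_def)
  have neg_w: "\<sim> w = x \<otimes> \<sim> b"
    by (simp add: w_def mv_imp_def mv_times_def)
  \<comment> \<open>\<open>w\<close> is what remains of \<open>a \<rightarrow> b\<close> once the factor \<open>\<sim> y\<close> of \<open>a\<close> is split off;
    each divisibility step below trades one implication for its converse.\<close>
  have "a \<rightarrow> b = \<sim> y \<rightarrow> w"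
    by (simp add: a_def w_def times_imp imp_exchange[of x])
  then have "a \<otimes> (a \<rightarrow> b) = x \<otimes> (\<sim> y \<otimes> (\<sim> y \<rightarrow> w))"
    by (simp add: a_def times_assoc)
  also have "\<dots> = x \<otimes> (w \<otimes> (y \<rightarrow> \<sim> w))"
    using divisibility[of "\<sim> y" w] imp_contrapos[of "\<sim> y" w] by simp
  also have "\<dots> = (x \<otimes> (x \<rightarrow> b)) \<otimes> (y \<rightarrow> \<sim> w)"
    by (simp add: w_def times_assoc)
  also have "\<dots> = (b \<otimes> (b \<rightarrow> x)) \<otimes> (y \<rightarrow> \<sim> w)"
    by (simp add: divisibility[of x b])
  also have "\<dots> = (y \<otimes> (y \<rightarrow> \<sim> w)) \<otimes> (\<sim> x \<otimes> (b \<rightarrow> x))"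
    unfolding b_def by (simp add: times_assoc times_comm times_left_comm)
  also have "\<dots> = (x \<otimes> \<sim> b \<otimes> (\<sim> w \<rightarrow> y)) \<otimes> (\<sim> x \<otimes> (b \<rightarrow> x))"
    using divisibility[of y "\<sim> w"] by (simp add: neg_w)
  also have "\<dots> = (\<sim> x \<otimes> x) \<otimes> (\<sim> b \<otimes> ((\<sim> w \<rightarrow> y) \<otimes> (b \<rightarrow> x)))"
    by (simp add: times_assoc times_comm times_left_comm del: times_neg)
  also have "\<dots> = \<zero>"
    by simp
  finally have zero: "b \<otimes> (b \<rightarrow> a) = \<zero>"
    by (simp add: divisibility[of b a])
  have neg: "\<sim> a = x \<rightarrow> y" "\<sim> b = y \<rightarrow> x"
    by (simp_all add: a_def b_def mv_times_def mv_imp_def)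
  have "(\<sim> a \<rightarrow> \<sim> b) \<rightarrow> \<sim> b = \<sim> (b \<otimes> (b \<rightarrow> a))"
    unfolding imp_contrapos[OF \<open>a \<in> carrier L\<close> \<open>b \<in> carrier L\<close>]
    by (simp add: mv_times_def mv_imp_def plus_comm)
  with zero show ?thesis
    by (simp add: join_eq neg[symmetric])
qed

section \<open>Implication filters as deductive systems\<close>

text \<open>
  Closure under meets alone does not give modus ponens, and here the powers enter: the meet
  \<open>m\<close> of \<open>x\<close> and \<open>x \<rightarrow> y\<close> satisfies \<open>m \<otimes> m \<le> x \<otimes> (x \<rightarrow> y) \<le> y\<close>. Conversely, modus ponens
  gives closure under \<open>\<otimes>\<close>, and \<open>x \<otimes> y\<close> lies below the meet of \<open>x\<close> and \<open>y\<close>.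
\<close>

lemma implication_filter_iff:
  "implication_filter L F \<longleftrightarrow>
    F \<subseteq> carrier L \<and> \<one> \<in> F \<and> (\<forall>x\<in>F. \<forall>y\<in>carrier L. x \<rightarrow> y \<in> F \<longrightarrow> y \<in> F)"
  (is "_ \<longleftrightarrow> ?deductive")
proof
  assume F: "implication_filter L F"
  then have sub: "F \<subseteq> carrier L"
    and up: "\<And>x y. \<lbrakk>x \<in> F; y \<in> carrier L; x \<rightarrow> y = \<one>\<rbrakk> \<Longrightarrow> y \<in> F"
    and meet: "\<And>x y. \<lbrakk>x \<in> F; y \<in> F\<rbrakk> \<Longrightarrow> x \<sqinter>\<^bsub>mv_order L\<^esub> y \<in> F"
    and power: "\<And>x n. x \<in> F \<Longrightarrow> mv_power L x n \<in> F"
    by (auto simp: implication_filter_def lattice_filter_def mv_order_def)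
  obtain x where "x \<in> F"
    using F by (auto simp: implication_filter_def lattice_filter_def)
  then have one: "\<one> \<in> F"
    using power[of x 0] by simp
  have "y \<in> F" if "x \<in> F" "y \<in> carrier L" "x \<rightarrow> y \<in> F" for x y
  proof -
    define m where "m = x \<sqinter>\<^bsub>mv_order L\<^esub> (x \<rightarrow> y)"
    have [simp]: "x \<in> carrier L" "y \<in> carrier L" "m \<in> carrier L"
      using that sub by (auto simp: m_def)
    have "m \<in> F"
      unfolding m_def using that by (intro meet)
    then have "m \<otimes> m \<in> F"
      using power[of m 2] by (simp add: numeral_2_eq_2)
    have "m \<rightarrow> x \<rightarrow> y = \<one>" "(x \<rightarrow> y) \<rightarrow> m \<rightarrow> y = \<one>"
      by (simp_all add: m_def meet_le1 meet_le2 imp_mono_left)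
    then have "m \<otimes> m \<rightarrow> y = \<one>"
      by (simp add: times_imp imp_trans[of m "x \<rightarrow> y" "m \<rightarrow> y"])
    then show ?thesis
      by (rule up[OF \<open>m \<otimes> m \<in> F\<close> \<open>y \<in> carrier L\<close>])
  qed
  with sub one show ?deductive
    by blast
next
  assume F: ?deductive
  then have sub: "\<And>x. x \<in> F \<Longrightarrow> x \<in> carrier L" and one: "\<one> \<in> F"
    and mp: "\<And>x y. \<lbrakk>x \<in> F; y \<in> carrier L; x \<rightarrow> y \<in> F\<rbrakk> \<Longrightarrow> y \<in> F"
    by blast+
  have times: "x \<otimes> y \<in> F" if "x \<in> F" "y \<in> F" for x y
  proof (rule mp[OF \<open>y \<in> F\<close>])
    have "x \<rightarrow> y \<rightarrow> x \<otimes> y = \<one>"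
      using that sub by (simp flip: times_imp)
    then show "y \<rightarrow> x \<otimes> y \<in> F"
      using that sub one mp[OF \<open>x \<in> F\<close>, of "y \<rightarrow> x \<otimes> y"] by simp
  qed (use that sub in auto)
  have meet: "x \<sqinter>\<^bsub>mv_order L\<^esub> y \<in> F" if "x \<in> F" "y \<in> F" for x y
  proof -
    have [simp]: "x \<in> carrier L" "y \<in> carrier L"
      using that sub by auto
    have "x \<otimes> y \<rightarrow> (x \<sqinter>\<^bsub>mv_order L\<^esub> y) = \<one>"
      by (intro meet_greatest) (simp_all add: times_imp imp_exchange[of x y x])
    with one show ?thesis
      using mp[OF times[OF that], of "x \<sqinter>\<^bsub>mv_order L\<^esub> y"] by simp
  qed
  have power: "mv_power L x n \<in> F" if "x \<in> F" for x n
    using that by (induction n) (simp_all add: one times)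
  have "y \<in> F" if "x \<in> F" "y \<in> carrier L" "x \<rightarrow> y = \<one>" for x y
    using mp[OF that(1,2)] that(3) one by simp
  then have up: "y \<in> F" if "x \<in> F" "y \<in> carrier L" "x \<sqsubseteq>\<^bsub>mv_order L\<^esub> y" for x y
    using that by (simp add: mv_order_def)
  show "implication_filter L F"
    unfolding implication_filter_def lattice_filter_def
    by (intro conjI ballI impI allI) (use one sub up meet power in blast)+
qed

lemma prime_implication_filter_iff:
  "prime_implication_filter L F \<longleftrightarrow>
    implication_filter L F \<and> F \<noteq> carrier L \<and>
    (\<forall>a\<in>carrier L. \<forall>b\<in>carrier L. (a \<rightarrow> b) \<rightarrow> b \<in> F \<longrightarrow> a \<in> F \<or> b \<in> F)"
  by (auto simp: prime_implication_filter_def join_eq)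

lemma implication_filterD:
  assumes "implication_filter L F"
  shows "x \<in> F \<Longrightarrow> x \<in> carrier L" and "\<one> \<in> F"
    and "x \<in> F \<Longrightarrow> x \<rightarrow> y \<in> F \<Longrightarrow> y \<in> carrier L \<Longrightarrow> y \<in> F"
  using assms unfolding implication_filter_iff by blast+

lemma implication_filter_up:
  assumes "implication_filter L F" "x \<in> F" "y \<in> carrier L" "x \<rightarrow> y = \<one>"
  shows "y \<in> F"
  by (rule implication_filterD(3)[OF assms(1,2)])
    (simp_all add: assms implication_filterD(2)[OF assms(1)])

section \<open>The primes containing the localizing filter\<close>

text \<open>
  Deductive systems are closed under intersection, and the whole algebra is one of those that
  contain the generators, so the hull is a deductive system.
\<close>

lemma implication_filter_localizing:
  assumes "prime_implication_filter L P"
  shows "implication_filter L (localizing_filter L P)"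
proof -
  let ?S = "{x \<rightarrow> p | x p. p \<in> P \<and> x \<in> carrier L - P}"
  have "P \<subseteq> carrier L"
    using assms implication_filterD(1) by (auto simp: prime_implication_filter_def)
  then have "implication_filter L (carrier L)" "?S \<subseteq> carrier L"
    by (auto simp: implication_filter_iff)
  then show ?thesis
    unfolding localizing_filter_def hull_def implication_filter_iff by blast
qed

text \<open>
  A filter \<open>F\<close> that contains the generator \<open>x \<rightarrow> p\<close> cannot have \<open>x \<in> F\<close> and \<open>p \<notin> F\<close>, and
  incomparability would supply such a generator. The converse inclusion uses primeness of \<open>F\<close> through prelinearity.
\<close>

lemma localizing_filter_subset_iff:
  assumes P: "prime_implication_filter L P" and F: "prime_implication_filter L F"
  shows "localizing_filter L P \<subseteq> F \<longleftrightarrow> F \<subseteq> P \<or> P \<subseteq> F"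
proof -
  note filters = P[unfolded prime_implication_filter_def, THEN conjunct1]
    F[unfolded prime_implication_filter_def, THEN conjunct1]
  note fP = implication_filterD[OF filters(1)] and fF = implication_filterD[OF filters(2)]
  show ?thesis
  proof
    assume le: "localizing_filter L P \<subseteq> F"
    show "F \<subseteq> P \<or> P \<subseteq> F"
    proof (rule ccontr)
      assume "\<not> (F \<subseteq> P \<or> P \<subseteq> F)"
      then obtain x p where "x \<in> F" "x \<notin> P" "p \<in> P" "p \<notin> F"
        by blast
      then have "x \<rightarrow> p \<in> localizing_filter L P"
        unfolding localizing_filter_def using fF(1) by (intro subsetD[OF hull_subset]) blast
      with le \<open>x \<in> F\<close> \<open>p \<in> P\<close> have "p \<in> F"
        using fF(3) fP(1) by blast
      with \<open>p \<notin> F\<close> show False ..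
    qed
  next
    assume comparable: "F \<subseteq> P \<or> P \<subseteq> F"
    have "x \<rightarrow> p \<in> F" if "p \<in> P" "x \<in> carrier L" "x \<notin> P" for x p
    proof -
      have [simp]: "p \<in> carrier L" "x \<in> carrier L"
        using that fP(1) by auto
      from comparable show ?thesis
      proof
        assume "P \<subseteq> F"
        with that have "p \<in> F"
          by blast
        then show ?thesis
          by (rule implication_filter_up[OF filters(2)]) simp_all
      next
        assume "F \<subseteq> P"
        have "(x \<rightarrow> p) \<squnion>\<^bsub>mv_order L\<^esub> (p \<rightarrow> x) \<in> F"
          by (simp add: prelinearity fF(2))
        then have "x \<rightarrow> p \<in> F \<or> p \<rightarrow> x \<in> F"
          using F by (simp add: prime_implication_filter_def)
        moreover have "p \<rightarrow> x \<notin> F"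
          using \<open>F \<subseteq> P\<close> fP(3)[of p x] that by auto
        ultimately show ?thesis
          by blast
      qed
    qed
    then show "localizing_filter L P \<subseteq> F"
      unfolding localizing_filter_def by (intro hull_minimal filters) blast
  qed
qed

end

section \<open>Prime filters of a homomorphic image\<close>

text \<open>
  All MV axioms are equations, so the image of an MV-algebra satisfies them again. The
  codomain is therefore only required to carry the operations, and the quotient
  construction needs no separate verification of the axioms.
\<close>

locale mv_epimorphism = mv_algebra L
  for L :: "('a, 'm) mv_structure_scheme" (structure)
    and M :: "('b, 'n) mv_structure_scheme" and h :: "'a \<Rightarrow> 'b" +
  assumes hom_image: "h ` carrier L = carrier M"
    and hom_plus [simp]: "\<lbrakk>x \<in> carrier L; y \<in> carrier L\<rbrakk> \<Longrightarrow> h x \<oplus>\<^bsub>M\<^esub> h y = h (x \<oplus> y)"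
    and hom_neg [simp]: "x \<in> carrier L \<Longrightarrow> \<sim>\<^bsub>M\<^esub> h x = h (\<sim> x)"
    and hom_zero [simp]: "\<zero>\<^bsub>M\<^esub> = h \<zero>"
begin

sublocale codomain: mv_algebra M
proof
  show "x \<oplus>\<^bsub>M\<^esub> y = y \<oplus>\<^bsub>M\<^esub> x" if "x \<in> carrier M" "y \<in> carrier M" for x y
    using that unfolding hom_image[symmetric] by (auto simp: plus_comm)
qed (unfold hom_image[symmetric], auto simp: plus_assoc plus_neg_zero lukasiewicz simp del: neg_zero)

lemma hom_one [simp]: "\<one>\<^bsub>M\<^esub> = h \<one>"
  by (simp add: mv_one_def del: neg_zero codomain.neg_zero)

lemma hom_imp [simp]:
  "x \<in> carrier L \<Longrightarrow> y \<in> carrier L \<Longrightarrow> h x \<rightarrow>\<^bsub>M\<^esub> h y = h (x \<rightarrow> y)"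
  by (simp add: mv_imp_def)

definition kernel :: "'a set"
  where "kernel = {x \<in> carrier L. h x = \<one>\<^bsub>M\<^esub>}"

text \<open>
  A filter above the kernel is saturated: if \<open>h x = h y\<close> with \<open>y \<in> F\<close>, then \<open>y \<rightarrow> x\<close> lies in
  the kernel, and modus ponens gives \<open>x \<in> F\<close>.
\<close>

lemma hom_mem_image_iff:
  assumes F: "implication_filter L F" "kernel \<subseteq> F" and x: "x \<in> carrier L"
  shows "h x \<in> h ` F \<longleftrightarrow> x \<in> F"
proof
  assume "h x \<in> h ` F"
  then obtain y where y: "y \<in> F" "h x = h y"
    by blast
  then have [simp]: "y \<in> carrier L"
    using F implication_filterD by blast
  have "h (y \<rightarrow> x) = h y \<rightarrow>\<^bsub>M\<^esub> h x"
    using x by simp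
  also have "\<dots> = h y \<rightarrow>\<^bsub>M\<^esub> h y"
    by (simp only: y)
  also have "\<dots> = h \<one>"
    by simp
  finally have "y \<rightarrow> x \<in> kernel"
    using x by (simp add: kernel_def)
  with F x y show "x \<in> F"
    using implication_filterD(3) by blast
qed simp

lemma prime_implication_filter_image:
  assumes F: "prime_implication_filter L F" "kernel \<subseteq> F"
  shows "prime_implication_filter M (h ` F)"
proof -
  have f: "implication_filter L F"
    using F by (simp add: prime_implication_filter_def)
  note fF = implication_filterD[OF f] and mem = hom_mem_image_iff[OF f F(2)]
  have "y \<in> h ` F" if xy: "x \<in> h ` F" "y \<in> carrier M" "x \<rightarrow>\<^bsub>M\<^esub> y \<in> h ` F" for x y
  proof -
    obtain a b where "a \<in> F" "x = h a" "b \<in> carrier L" "y = h b"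
      using xy unfolding hom_image[symmetric] by blast
    moreover from this xy(3) have "a \<rightarrow> b \<in> F"
      using fF(1) by (simp add: mem)
    ultimately show ?thesis
      using fF(3) by blast
  qed
  moreover have "h ` F \<subseteq> carrier M"
    using fF(1) hom_image by blast
  moreover have "\<one>\<^bsub>M\<^esub> \<in> h ` F"
    using fF(2) by simp
  ultimately have "implication_filter M (h ` F)"
    unfolding codomain.implication_filter_iff by blast
  moreover have "h ` F \<noteq> carrier M"
  proof
    assume "h ` F = carrier M"
    then have "carrier L \<subseteq> F"
      using mem hom_image by blast
    with F show False
      using fF(1) by (auto simp: prime_implication_filter_def)
  qed
  moreover have "x \<in> h ` F \<or> y \<in> h ` F"
    if xy: "x \<in> carrier M" "y \<in> carrier M" "(x \<rightarrow>\<^bsub>M\<^esub> y) \<rightarrow>\<^bsub>M\<^esub> y \<in> h ` F" for x y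
  proof -
    obtain a b where ab: "a \<in> carrier L" "x = h a" "b \<in> carrier L" "y = h b"
      using xy unfolding hom_image[symmetric] by blast
    with xy(3) have "(a \<rightarrow> b) \<rightarrow> b \<in> F"
      by (simp add: mem)
    with F(1) ab show ?thesis
      unfolding prime_implication_filter_iff by blast
  qed
  ultimately show ?thesis
    unfolding codomain.prime_implication_filter_iff by blast
qed

lemma prime_implication_filter_vimage:
  assumes N: "prime_implication_filter M N"
  defines "F \<equiv> {x \<in> carrier L. h x \<in> N}"
  shows "prime_implication_filter L F" and "kernel \<subseteq> F" and "h ` F = N"
proof -
  have n: "implication_filter M N" and proper: "N \<noteq> carrier M"
    and prime: "\<And>x y. \<lbrakk>x \<in> carrier M; y \<in> carrier M; (x \<rightarrow>\<^bsub>M\<^esub> y) \<rightarrow>\<^bsub>M\<^esub> y \<in> N\<rbrakk> \<Longrightarrow> x \<in> N \<or> y \<in> N"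
    using N unfolding codomain.prime_implication_filter_iff by blast+
  note nN = codomain.implication_filterD[OF n]
  have h: "h x \<in> carrier M" if "x \<in> carrier L" for x
    using that unfolding hom_image[symmetric] by blast
  show image: "h ` F = N"
    using nN(1) unfolding F_def hom_image[symmetric] by blast
  show "kernel \<subseteq> F"
    using nN(2) by (auto simp: kernel_def F_def)
  have "y \<in> F" if "x \<in> F" "y \<in> carrier L" "x \<rightarrow> y \<in> F" for x y
    using that nN(3)[of "h x" "h y"] h by (simp add: F_def)
  moreover have "F \<subseteq> carrier L" "\<one> \<in> F"
    using nN(2) by (auto simp: F_def)
  ultimately have "implication_filter L F"
    unfolding implication_filter_iff by blast
  moreover have "F \<noteq> carrier L"
    using image proper hom_image by blast
  moreover have "x \<in> F \<or> y \<in> F"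
    if "x \<in> carrier L" "y \<in> carrier L" "(x \<rightarrow> y) \<rightarrow> y \<in> F" for x y
    using that prime[of "h x" "h y"] h by (simp add: F_def)
  ultimately show "prime_implication_filter L F"
    unfolding prime_implication_filter_iff by blast
qed

text \<open>
  Taking images is an order embedding by saturation, and it is onto because a prime of the
  codomain is the image of its preimage.
\<close>

theorem inclusion_isomorphic_PSpec:
  "inclusion_isomorphic {F \<in> PSpec L. kernel \<subseteq> F} (PSpec M)"
  unfolding inclusion_isomorphic_def
proof (intro exI conjI ballI)
  let ?A = "{F \<in> PSpec L. kernel \<subseteq> F}"
  show mono: "F \<subseteq> G \<longleftrightarrow> h ` F \<subseteq> h ` G" if "F \<in> ?A" "G \<in> ?A" for F G
  proof -
    have f: "implication_filter L F" "implication_filter L G" "kernel \<subseteq> G"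
      using that by (auto simp: PSpec_def prime_implication_filter_def)
    show ?thesis
      using hom_mem_image_iff[OF f(2,3)] implication_filterD(1)[OF f(1)] by blast
  qed
  show "bij_betw ((`) h) ?A (PSpec M)"
    unfolding bij_betw_def
  proof
    show "inj_on ((`) h) ?A"
      using mono by (intro inj_onI) (simp add: set_eq_subset)
    show "(`) h ` ?A = PSpec M"
    proof
      show "(`) h ` ?A \<subseteq> PSpec M"
        using prime_implication_filter_image by (auto simp: PSpec_def)
      show "PSpec M \<subseteq> (`) h ` ?A"
      proof
        fix N assume "N \<in> PSpec M"
        then have N: "prime_implication_filter M N"
          by (simp add: PSpec_def)
        show "N \<in> (`) h ` ?A"
          using prime_implication_filter_vimage[OF N]
          by (intro image_eqI[where x = "{x \<in> carrier L. h x \<in> N}"]) (auto simp: PSpec_def)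
      qed
    qed
  qed
qed

end

section \<open>The quotient map\<close>

context mv_algebra
begin

text \<open>
  Since \<open>a \<oplus> b = \<sim> b \<rightarrow> a\<close>, this is the syllogism law with its premises exchanged. It makes
  the relation of a filter compatible with sums.
\<close>

lemma imp_plus_mono:
  assumes [simp]: "a \<in> carrier L" "a' \<in> carrier L" "b \<in> carrier L"
  shows "(a \<rightarrow> a') \<rightarrow> a \<oplus> b \<rightarrow> a' \<oplus> b = \<one>"
proof -
  have "a \<oplus> b = \<sim> b \<rightarrow> a" "a' \<oplus> b = \<sim> b \<rightarrow> a'"
    by (simp_all add: mv_imp_def plus_comm)
  then show ?thesis
    using imp_syllogism[of "\<sim> b" a a']
      imp_exchange[of "\<sim> b \<rightarrow> a" "a \<rightarrow> a'" "\<sim> b \<rightarrow> a'"] by simp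
qed

context
  fixes G
  assumes G: "implication_filter L G"
begin

lemma equiv_filter_cong: "equiv (carrier L) (filter_cong L G)"
proof (rule equivI)
  note fG = implication_filterD[OF G]
  show "refl_on (carrier L) (filter_cong L G)"
    by (auto simp: refl_on_def filter_cong_def fG)
  show "sym (filter_cong L G)"
    by (auto simp: sym_def filter_cong_def)
  have "a \<rightarrow> c \<in> G"
    if c: "a \<in> carrier L" "b \<in> carrier L" "c \<in> carrier L"
      and ab: "a \<rightarrow> b \<in> G" and bc: "b \<rightarrow> c \<in> G" for a b c
  proof -
    have "(b \<rightarrow> c) \<rightarrow> a \<rightarrow> c \<in> G"
      by (rule implication_filter_up[OF G ab _ imp_syllogism]) (simp_all add: c)
    then show ?thesis
      by (rule fG(3)[OF bc]) (simp add: c)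
  qed
  then show "trans (filter_cong L G)"
    unfolding trans_def filter_cong_def by blast
qed (auto simp: filter_cong_def)

lemma filter_cong_neg: "(a, a') \<in> filter_cong L G \<Longrightarrow> (\<sim> a, \<sim> a') \<in> filter_cong L G"
  by (auto simp: filter_cong_def imp_contrapos)

lemma filter_cong_plus_left:
  assumes "(a, a') \<in> filter_cong L G" "b \<in> carrier L"
  shows "(a \<oplus> b, a' \<oplus> b) \<in> filter_cong L G"
  using assms implication_filter_up[OF G _ _ imp_plus_mono, of a a' b]
    implication_filter_up[OF G _ _ imp_plus_mono, of a' a b]
  by (simp add: filter_cong_def)

lemma filter_cong_plus:
  assumes "(a, a') \<in> filter_cong L G" "(b, b') \<in> filter_cong L G"
  shows "(a \<oplus> b, a' \<oplus> b') \<in> filter_cong L G"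
proof -
  have "a' \<in> carrier L" "b \<in> carrier L" "b' \<in> carrier L"
    using assms by (auto simp: filter_cong_def)
  then have "(a \<oplus> b, a' \<oplus> b) \<in> filter_cong L G" "(a' \<oplus> b, a' \<oplus> b') \<in> filter_cong L G"
    using assms filter_cong_plus_left[of b b' a'] by (simp_all add: filter_cong_plus_left plus_comm)
  then show ?thesis
    using equiv_filter_cong by (auto simp: equiv_def elim: transE)
qed

lemma mv_epimorphism_quotient:
  "mv_epimorphism L (mv_quotient L G) (\<lambda>a. filter_cong L G `` {a})"
proof (unfold_locales)
  let ?R = "filter_cong L G"
  note class_eq = equiv_class_eq[OF equiv_filter_cong]
  note self = equiv_class_self[OF equiv_filter_cong]
  show "(\<lambda>a. ?R `` {a}) ` carrier L = carrier (mv_quotient L G)"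
    by (auto simp: mv_quotient_def quotient_def)
  show "?R `` {a} \<oplus>\<^bsub>mv_quotient L G\<^esub> ?R `` {b} = ?R `` {a \<oplus> b}"
    if "a \<in> carrier L" "b \<in> carrier L" for a b
  proof -
    have "?R `` {a' \<oplus> b'} = ?R `` {a \<oplus> b}" if "a' \<in> ?R `` {a}" "b' \<in> ?R `` {b}" for a' b'
      using that filter_cong_plus[of a a' b b'] class_eq by (metis Image_singleton_iff)
    then have "(\<Union>a'\<in>?R `` {a}. \<Union>b'\<in>?R `` {b}. ?R `` {a' \<oplus> b'})
        = (\<Union>a'\<in>?R `` {a}. \<Union>b'\<in>?R `` {b}. ?R `` {a \<oplus> b})"
      by (intro SUP_cong refl)
    also have "\<dots> = ?R `` {a \<oplus> b}"
      using self[OF that(1)] self[OF that(2)] by blast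
    finally show ?thesis
      by (simp add: mv_quotient_def)
  qed
  show "\<sim>\<^bsub>mv_quotient L G\<^esub> ?R `` {a} = ?R `` {\<sim> a}" if "a \<in> carrier L" for a
  proof -
    have "?R `` {\<sim> a'} = ?R `` {\<sim> a}" if "a' \<in> ?R `` {a}" for a'
      using that filter_cong_neg[of a a'] class_eq by (metis Image_singleton_iff)
    then have "(\<Union>a'\<in>?R `` {a}. ?R `` {\<sim> a'}) = (\<Union>a'\<in>?R `` {a}. ?R `` {\<sim> a})"
      by (intro SUP_cong refl)
    also have "\<dots> = ?R `` {\<sim> a}"
      using self[OF that] by blast
    finally show ?thesis
      by (simp add: mv_quotient_def)
  qed
qed (simp add: mv_quotient_def)

lemma kernel_quotient:
  "mv_epimorphism.kernel L (mv_quotient L G) (\<lambda>a. filter_cong L G `` {a}) = G"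
proof -
  interpret q: mv_epimorphism L "mv_quotient L G" "\<lambda>a. filter_cong L G `` {a}"
    by (rule mv_epimorphism_quotient)
  note fG = implication_filterD[OF G]
  have "filter_cong L G `` {x} = filter_cong L G `` {\<one>} \<longleftrightarrow> x \<in> G" if "x \<in> carrier L" for x
    using that fG(2)
    by (subst eq_equiv_class_iff[OF equiv_filter_cong]) (simp_all add: filter_cong_def)
  then show ?thesis
    using fG(1) by (auto simp: q.kernel_def)
qed

end

end

theorem theorem3p9:
  fixes L :: "('a, 'm) mv_structure_scheme"
  assumes "mv_algebra L"
    and "prime_implication_filter L P"
  shows "inclusion_isomorphic (PSpec_at L P) (PSpec (localization L P))"
proof -
  interpret mv_algebra L
    by (fact assms)
  have filter: "implication_filter L (localizing_filter L P)"
    by (rule implication_filter_localizing) (fact assms)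
  have "PSpec_at L P = {F \<in> PSpec L. localizing_filter L P \<subseteq> F}"
    using localizing_filter_subset_iff[OF assms(2)] by (auto simp: PSpec_at_def PSpec_def)
  then show ?thesis
    using mv_epimorphism.inclusion_isomorphic_PSpec[OF mv_epimorphism_quotient[OF filter]]
    by (simp add: kernel_quotient[OF filter] localization_def)
qed

end
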